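(* Let $N\ge 1$ be an integer, $m\ge1$ a divisor of $N$, and $n\in\mathbb{Z}$. For $l\in\{1,\dots,m\}$ let $\mathscr{L}_l$ be the subgroup of $\mathbb{Z}_N\times\mathbb{Z}_N$ consisting of the elements $$\left(qm+p\Big(n+l\frac{N}{m}\Big),\ p\frac{N}{m}\right),\qquad q,p\in\mathbb{Z},$$ and set $r_l=\gcd\!\left(m,\,n+l\frac{N}{m}\right)$. Then the subgroup of elements of $\mathscr{L}_l$ whose first component is zero in $\mathbb{Z}_N$ is generated by $\left(0,\frac{N}{r_l}\right)$, and is thus isomorphic to $\mathbb{Z}_{r_l}$. Consequently the index $I^{\mathcal N=1}(N,m,n)$ defined in the context equals $$I^{\mathcal N=1}(N,m,n)=\frac{N}{m}\sum_{l=1}^{m}\gcd\!\left(m,\ n+\frac{lN}{m}\right).$$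
   Context: $\mathbb{Z}_k=\mathbb{Z}/k\mathbb{Z}$. The gcd is positive, with $\gcd(a,0)=|a|$. Physically, elements of $\mathbb{Z}_N\times\mathbb{Z}_N$ are (electric, magnetic) charges of line operators in the pure $\mathcal{N}=1$ theory $(\mathrm{SU}(N)/\mathbb{Z}_m)_n$, and $\mathscr{L}_l$ is the spectrum of line operators in the $l$-th inequivalent vacuum on $\mathbb{R}^4$, after shifting the $\theta$-angle so that the condensate is purely magnetic. A line operator of zero electric charge mod $N$ obeys a perimeter law, and these purely magnetic line operators form the unbroken magnetic gauge group. There are $N$ vacua on $\mathbb{R}^4$, falling into $m$ inequivalent types $l=1,\dots,m$, each type occurring $N/m$ times. Upon compactification on a circle each vacuum of type $l$ acquires a multiplicity equal to the order of its unbroken magnetic gauge group. Accordingly, the index is defined as $$I^{\mathcal N=1}(N,m,n)=\frac{N}{m}\sum_{l=1}^{m}\#\{x\in\mathscr{L}_l:\ \text{the first component of }x\text{ is }0\in\mathbb{Z}_N\}.$$ *)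

theory Defs
  imports "HOL-Algebra.Elementary_Groups"
begin

definition charge_group :: "nat \<Rightarrow> (int \<times> int) monoid" where
  "charge_group N = integer_mod_group N \<times>\<times> integer_mod_group N"

(* The residue class of an integer a in Z_N is represented by a mod int N, the element of
   carrier (integer_mod_group N) = {0..<int N} congruent to it.  All uses of "div" below are
   exact divisions as soon as m divides N. *)

definition line_spectrum :: "nat \<Rightarrow> nat \<Rightarrow> int \<Rightarrow> nat \<Rightarrow> (int \<times> int) set" where
  "line_spectrum N m n l =
    {((q * int m + p * (n + int l * int (N div m))) mod int N,
      (p * int (N div m)) mod int N) | q p :: int. True}"

definition unbroken_magnetic :: "nat \<Rightarrow> nat \<Rightarrow> int \<Rightarrow> nat \<Rightarrow> (int \<times> int) set" where
  "unbroken_magnetic N m n l =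
    {x \<in> line_spectrum N m n l. fst x = \<one>\<^bsub>integer_mod_group N\<^esub>}"

definition vacuum_gcd :: "nat \<Rightarrow> nat \<Rightarrow> int \<Rightarrow> nat \<Rightarrow> nat" where
  "vacuum_gcd N m n l = nat (gcd (int m) (n + int l * int (N div m)))"

definition index_N1 :: "nat \<Rightarrow> nat \<Rightarrow> int \<Rightarrow> nat" where
  "index_N1 N m n = (N div m) * (\<Sum>l = 1..m. card (unbroken_magnetic N m n l))"

end

theory Submission
  imports Defs
begin

(* With d = N/m and a = n + l d, the first component q m + p a vanishes modulo N for some q
   iff m divides p a, i.e. iff m/r divides p where r = gcd(m, a).  The second components p d
   are then exactly the multiples of (m/r) d = N/r, which form a cyclic group of order r in Z_N. *)

lemma group_charge_group: "group (charge_group N)"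
  by (simp add: charge_group_def DirProd_group)

lemma carrier_charge_group:
  assumes "N \<ge> 1"
  shows "carrier (charge_group N) = {0..<int N} \<times> {0..<int N}"
  using assms by (simp add: charge_group_def carrier_integer_mod_group)

lemma mult_charge_group:
  "x \<otimes>\<^bsub>charge_group N\<^esub> y = ((fst x + fst y) mod int N, (snd x + snd y) mod int N)"
  by (simp add: charge_group_def DirProd_def case_prod_beta)

lemma inv_charge_group:
  assumes "x \<in> carrier (charge_group N)"
  shows "inv\<^bsub>charge_group N\<^esub> x = ((- fst x) mod int N, (- snd x) mod int N)"
  using assms
  by (cases x) (simp add: charge_group_def inv_DirProd)

text \<open>Both projections are homomorphisms to \<open>integer_mod_group N\<close>, where a power
  is a multiple reduced mod \<open>N\<close>. This makes the subgroup generated by one charge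
  explicit.\<close>

lemma int_pow_charge_group:
  fixes k :: int
  assumes "x \<in> carrier (charge_group N)"
  shows "x [^]\<^bsub>charge_group N\<^esub> k = ((k * fst x) mod int N, (k * snd x) mod int N)"
proof -
  let ?Z = "integer_mod_group N"
  have "fst \<in> hom (charge_group N) ?Z" "snd \<in> hom (charge_group N) ?Z"
    by (auto simp: hom_def charge_group_def)
  then have "group_hom (charge_group N) ?Z fst" "group_hom (charge_group N) ?Z snd"
    by (simp_all add: group_hom_def group_hom_axioms_def group_charge_group)
  from this[THEN group_hom.hom_int_pow, OF assms, of k]
  show ?thesis
    by (simp add: int_pow_integer_mod_group prod_eq_iff)
qed

text \<open>The spectrum is the image of Z x Z under a homomorphism in \<open>(q, p)\<close>, so
  negating and adding the parameters witnesses closure.\<close>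

lemma subgroup_line_spectrum:
  assumes "N \<ge> 1"
  shows "subgroup (line_spectrum N m n l) (charge_group N)"
proof (rule group.subgroupI[OF group_charge_group])
  show sub: "line_spectrum N m n l \<subseteq> carrier (charge_group N)"
    using assms by (auto simp: line_spectrum_def carrier_charge_group)
  show "line_spectrum N m n l \<noteq> {}"
    by (auto simp: line_spectrum_def)
  let ?a = "n + int l * int (N div m)"
  fix x assume x: "x \<in> line_spectrum N m n l"
  then obtain q p where qp: "x = ((q * int m + p * ?a) mod int N, (p * int (N div m)) mod int N)"
    unfolding line_spectrum_def by blast
  have "inv\<^bsub>charge_group N\<^esub> x =
      (((-q) * int m + (-p) * ?a) mod int N, ((-p) * int (N div m)) mod int N)"
    unfolding inv_charge_group[OF subsetD[OF sub x]]
    by (simp add: qp mod_minus_eq)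
  then show "inv\<^bsub>charge_group N\<^esub> x \<in> line_spectrum N m n l"
    unfolding line_spectrum_def by blast
  fix y assume "y \<in> line_spectrum N m n l"
  then obtain q' p' where qp': "y = ((q' * int m + p' * ?a) mod int N, (p' * int (N div m)) mod int N)"
    unfolding line_spectrum_def by blast
  have "x \<otimes>\<^bsub>charge_group N\<^esub> y =
      (((q + q') * int m + (p + p') * ?a) mod int N, ((p + p') * int (N div m)) mod int N)"
    unfolding mult_charge_group qp qp'
    by (simp add: mod_add_eq algebra_simps)
  then show "x \<otimes>\<^bsub>charge_group N\<^esub> y \<in> line_spectrum N m n l"
    unfolding line_spectrum_def by blast
qed

lemma int_vacuum_gcd: "int (vacuum_gcd N m n l) = gcd (int m) (n + int l * int (N div m))"
  by (simp add: vacuum_gcd_def)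

lemma vacuum_gcd_dvd: "vacuum_gcd N m n l dvd m"
  by (metis int_vacuum_gcd gcd_dvd1 int_dvd_int_iff)

text \<open>Common starting point for the generator and for the isomorphism type: the integer
  parameter \<open>k\<close> becomes the exponent of the generator in the first case and a residue
  mod \<open>r\<close> in the second.\<close>

lemma unbroken_magnetic_eq:
  assumes "N \<ge> 1" and "m dvd N"
  shows "unbroken_magnetic N m n l =
    range (\<lambda>k. (0, (k * int (N div vacuum_gcd N m n l)) mod int N))"
proof -
  define r where "r = vacuum_gcd N m n l"
  define d where "d = N div m"
  define a where "a = n + int l * int d"
  define m' where "m' = m div r"
  have N: "N = m * d" using assms by (simp add: d_def)
  have m: "m = r * m'" using vacuum_gcd_dvd by (simp add: m'_def r_def)
  have pos: "m > 0" "d > 0" "r > 0" "m' > 0" using assms N m by (auto intro: Nat.gr0I)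
  have r: "int r = gcd (int m) a" unfolding r_def a_def d_def by (rule int_vacuum_gcd)
  obtain a' where a': "a = int r * a'" using r by (metis dvdE gcd_dvd2)
  have cop: "coprime (int m') a'"
  proof -
    \<comment> \<open>Pull the factor \<open>r\<close> out of gcd(r m', r a') = r; cancelling it
      leaves gcd 1.\<close>
    have "int r * gcd (int m') a' = int r"
      using r unfolding m a' by (simp add: gcd_mult_left)
    then show ?thesis using pos by (simp add: coprime_iff_gcd_eq_1)
  qed
  have Nr: "N div r = m' * d" using pos by (simp add: N m)
  have vanish: "(\<exists>q. (q * int m + p * a) mod int N = 0) \<longleftrightarrow> int m' dvd p" for p
  proof -
    have "(\<exists>q. (q * int m + p * a) mod int N = 0) \<longleftrightarrow> int m dvd p * a"
    proof
      assume "\<exists>q. (q * int m + p * a) mod int N = 0"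
      then obtain q where "int N dvd q * int m + p * a" by auto
      \<comment> \<open>\<open>m\<close> is a factor of \<open>N\<close>, and modulo
        \<open>m\<close> the term with \<open>q\<close> disappears.\<close>
      then have "int m dvd q * int m + p * a" unfolding N of_nat_mult by (rule dvd_mult_left)
      then show "int m dvd p * a" by (simp add: dvd_add_right_iff)
    next
      assume "int m dvd p * a"
      then obtain c where "p * a = int m * c" ..
      \<comment> \<open>Choosing \<open>q = -c\<close> makes the first component zero already as an
        integer, before reduction.\<close>
      then have "(-c) * int m + p * a = 0" by simp
      then show "\<exists>q. (q * int m + p * a) mod int N = 0" by (metis mod_0)
    qed
    \<comment> \<open>Cancel \<open>r\<close> from \<open>m = r * m'\<close> and
      \<open>a = r * a'\<close>; coprimality then removes \<open>a'\<close>.\<close>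
    also have "\<dots> \<longleftrightarrow> int m' dvd p * a'"
      using pos by (simp add: m a' mult.left_commute)
    also have "\<dots> \<longleftrightarrow> int m' dvd p"
      using cop by (simp add: coprime_dvd_mult_left_iff)
    finally show ?thesis .
  qed
  \<comment> \<open>The second component does not involve \<open>q\<close>, so \<open>q\<close> can
    be quantified away by \<open>vanish\<close>, leaving a condition on \<open>p\<close>
    alone.\<close>
  have "unbroken_magnetic N m n l = {(0, (p * int d) mod int N) | p. int m' dvd p}"
    unfolding unbroken_magnetic_def line_spectrum_def vanish[symmetric]
    by (fold d_def, fold a_def) (auto simp: mod_eq_0_iff_dvd, blast+)
  also have "\<dots> = range (\<lambda>k. (0, (k * int (m' * d)) mod int N))"
  proof -
    have "{p. int m' dvd p} = range (\<lambda>k. k * int m')"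
      by (auto elim!: dvdE simp: mult.commute)
    then show ?thesis
      by (simp add: setcompr_eq_image image_image mult.assoc)
  qed
  finally show ?thesis by (simp add: Nr flip: r_def)
qed

text \<open>The integer powers of the generator are exactly the multiples found above. Its second
  entry is reduced because for \<open>r = 1\<close> the quotient is \<open>N\<close> itself, which
  represents 0.\<close>

lemma unbroken_magnetic_generate:
  assumes "N \<ge> 1" and "m dvd N"
  shows "unbroken_magnetic N m n l =
    generate (charge_group N) {(0, int (N div vacuum_gcd N m n l) mod int N)}"
proof -
  let ?g = "(0, int (N div vacuum_gcd N m n l) mod int N)"
  have g: "?g \<in> carrier (charge_group N)"
    using assms by (simp add: carrier_charge_group)
  show ?thesis
    unfolding unbroken_magnetic_eq[OF assms] group.generate_pow[OF group_charge_group g]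
      int_pow_charge_group[OF g]
    by (auto simp: mod_mult_right_eq)
qed

text \<open>The map needs no reduction: for a representative \<open>k\<close> below
  \<open>r\<close>, the product of \<open>k\<close> and \<open>N div r\<close> is already below
  \<open>N\<close>.\<close>

lemma multiples_iso:
  assumes "N \<ge> 1" and "r dvd N"
  shows "(\<lambda>k. (0, k * int (N div r))) \<in> iso (integer_mod_group r)
    ((charge_group N)\<lparr>carrier := range (\<lambda>k. (0, (k * int (N div r)) mod int N))\<rparr>)"
proof -
  define e where "e = N div r"
  have N: "N = r * e" using assms by (simp add: e_def)
  have pos: "r > 0" "e > 0" using assms N by (auto intro: Nat.gr0I)
  \<comment> \<open>Since \<open>N = r * e\<close>, reducing a multiple of \<open>e\<close> mod
    \<open>N\<close> is reducing its coefficient mod \<open>r\<close>. Both surjectivity and the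
    homomorphism law rest on this.\<close>
  have mod: "(k * int e) mod int N = (k mod int r) * int e" for k
    by (simp add: N mod_mult_mult2)
  have "bij_betw (\<lambda>k. (0::int, k * int e)) {0..<int r} (range (\<lambda>k. (0, (k mod int r) * int e)))"
    unfolding bij_betw_def
  proof
    show "inj_on (\<lambda>k. (0::int, k * int e)) {0..<int r}"
      using pos by (auto simp: inj_on_def)
    have "range (\<lambda>k. k mod int r) = {0..<int r}"
    proof
      show "{0..<int r} \<subseteq> range (\<lambda>k. k mod int r)"
        by (metis atLeastLessThan_iff mod_pos_pos_trivial rangeI subsetI)
    qed (use pos in auto)
    then show "(\<lambda>k. (0::int, k * int e)) ` {0..<int r} = range (\<lambda>k. (0, (k mod int r) * int e))"
      by (metis (no_types, lifting) image_cong image_image)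
  qed
  moreover have "((i + j) mod int r) * int e = (i * int e + j * int e) mod int N" for i j
    by (simp add: mod flip: distrib_right)
  ultimately show ?thesis
    using pos bij_betwE unfolding iso_def hom_def e_def[symmetric] mod
    by (fastforce simp: carrier_integer_mod_group mult_charge_group)
qed

lemma iso_unbroken_magnetic:
  assumes "N \<ge> 1" and "m dvd N"
  shows "integer_mod_group (vacuum_gcd N m n l) \<cong>
    (charge_group N)\<lparr>carrier := unbroken_magnetic N m n l\<rparr>"
  using multiples_iso[OF assms(1) dvd_trans[OF vacuum_gcd_dvd assms(2)]]
  unfolding unbroken_magnetic_eq[OF assms] is_iso_def by blast

lemma card_unbroken_magnetic:
  assumes "N \<ge> 1" and "m dvd N"
  shows "card (unbroken_magnetic N m n l) = vacuum_gcd N m n l"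
proof -
  \<comment> \<open>Positivity excludes \<open>integer_mod_group 0\<close>, whose carrier is all of
    the integers.\<close>
  have "vacuum_gcd N m n l > 0"
    using assms(1) dvd_pos_nat[OF _ dvd_trans[OF vacuum_gcd_dvd assms(2)]] by simp
  then show ?thesis
    using iso_same_card[OF iso_unbroken_magnetic[OF assms], of n l]
    by (simp add: carrier_integer_mod_group)
qed

theorem mainTheorem5:
  fixes N m :: nat and n :: int
  assumes "N \<ge> 1" and "m \<ge> 1" and "m dvd N"
  shows "(\<forall>l \<in> {1..m}.
            subgroup (line_spectrum N m n l) (charge_group N) \<and>
            subgroup (unbroken_magnetic N m n l) (charge_group N) \<and>
            unbroken_magnetic N m n l =
              generate (charge_group N) {(0, int (N div vacuum_gcd N m n l) mod int N)} \<and>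
            (charge_group N)\<lparr>carrier := unbroken_magnetic N m n l\<rparr>
              \<cong> integer_mod_group (vacuum_gcd N m n l)) \<and>
         int (index_N1 N m n) =
           int (N div m) * (\<Sum>l = 1..m. gcd (int m) (n + int (l * N div m)))"
proof (intro conjI ballI)
  fix l
  show "subgroup (line_spectrum N m n l) (charge_group N)"
    by (rule subgroup_line_spectrum[OF assms(1)])
  show gen: "unbroken_magnetic N m n l =
      generate (charge_group N) {(0, int (N div vacuum_gcd N m n l) mod int N)}"
    by (rule unbroken_magnetic_generate[OF assms(1,3)])
  show "subgroup (unbroken_magnetic N m n l) (charge_group N)"
    unfolding gen using assms(1)
    by (intro group.generate_is_subgroup[OF group_charge_group]) (simp add: carrier_charge_group)
  show "(charge_group N)\<lparr>carrier := unbroken_magnetic N m n l\<rparr>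
      \<cong> integer_mod_group (vacuum_gcd N m n l)"
    by (rule group.iso_sym[OF group_integer_mod_group iso_unbroken_magnetic[OF assms(1,3)]])
next
  \<comment> \<open>\<open>l * N div m\<close> parses as \<open>(l * N) div m\<close>; as
    \<open>m\<close> divides \<open>N\<close>, it equals \<open>l * (N div m)\<close>, the form used
    in \<open>vacuum_gcd\<close>.\<close>
  show "int (index_N1 N m n) =
      int (N div m) * (\<Sum>l = 1..m. gcd (int m) (n + int (l * N div m)))"
    using assms(3)
    by (simp add: index_N1_def card_unbroken_magnetic[OF assms(1,3)] int_vacuum_gcd
        flip: div_mult_swap)
qed

end
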